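(* Let $n>0$ be real and $0<p<1$, and let $X$ have the negative binomial distribution with parameters $n$ and $p$, i.e. $\mathbb{P}(X=x)=\binom{x+n-1}{n-1}(1-p)^np^x$ for $x\in\{0,1,2,\dots\}$. For $i\in\{0,1,2\}$ let $F_i$ be the cumulative distribution function of the negative binomial distribution with parameters $n+i$ and $p$. Then for every integer $r$, the first-order, complementary and second-order loss functions of $X$ are $$L_1(r)=\frac{np}{1-p}\,[1-F_1(r-2)]-r\,[1-F_0(r-1)],$$ $$L_c(r)=r\,F_0(r-1)-\frac{np}{1-p}\,F_1(r-2),$$ $$L_2(r)=\left(\frac{r^2+r}{2}\right)[1-F_0(r-1)]-\frac{rnp}{1-p}\,[1-F_1(r-2)]+\frac{(np)^2+np^2}{2(1-p)^2}\,[1-F_2(r-3)].$$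
   Context: For an integer-valued random variable $X$ with probability mass function $f$, the first-order loss function is $L_1(r)=\sum_{x\ge r}(x-r)f(x)$, the complementary loss function is $L_c(r)=\sum_{x\le r}(r-x)f(x)$, and the second-order loss function is $L_2(r)=\frac12\sum_{x\ge r}(x-r)(x-r-1)f(x)$, the sums running over integers $x$ in the range (support) of $X$. For non-integer $n$ the binomial coefficient is interpreted as $\binom{x+n-1}{n-1}=\frac{\Gamma(x+n)}{\Gamma(n)\,x!}$. The cumulative distribution function is $F(y)=\mathbb{P}(X\le y)$, in particular it is $0$ at negative arguments. *)

theory Defs
  imports "HOL-Probability.Probability"
begin

text \<open>The binomial coefficient with non-integer \<open>n\<close> is read as
  \<open>\<Gamma>(x + n) / (\<Gamma>(n) x!)\<close>; \<open>p\<close> is the parameter raised to the power \<open>x\<close>.\<close>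

definition negbin_mass :: "real \<Rightarrow> real \<Rightarrow> nat \<Rightarrow> real" where
  "negbin_mass n p x = Gamma (real x + n) / (Gamma n * fact x) * (1 - p) powr n * p ^ x"

text \<open>The library's \<open>neg_binomial_pmf\<close> only covers natural numbers \<open>n\<close>, hence the separate
  definition; \<open>pmf_negbin\<close> below shows that \<open>embed_pmf\<close> is applied to a genuine
  probability mass function.\<close>

definition negbin_pmf :: "real \<Rightarrow> real \<Rightarrow> nat pmf" where
  "negbin_pmf n p = embed_pmf (negbin_mass n p)"

definition negbin_cdf :: "real \<Rightarrow> real \<Rightarrow> real \<Rightarrow> real" where
  "negbin_cdf n p = cdf (measure_pmf (map_pmf real (negbin_pmf n p)))"

lemma negbin_mass_nonneg:
  assumes "n > 0" "0 < p" "p < 1"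
  shows "negbin_mass n p x \<ge> 0"
  using assms by (auto simp: negbin_mass_def intro!: mult_nonneg_nonneg divide_nonneg_nonneg
      Gamma_real_nonneg)

lemma negbin_mass_sums:
  assumes "n > 0" "0 < p" "p < 1"
  shows "negbin_mass n p sums 1"
proof -
  have "(\<lambda>x. ((-n) gchoose x) * (-p) ^ x) sums (1 + (-p)) powr (-n)"
    using assms by (intro gen_binomial_real) auto
  then have "(\<lambda>x. (1 - p) powr n * (((-n) gchoose x) * (-p) ^ x)) sums
      ((1 - p) powr n * (1 + (-p)) powr (-n))"
    by (rule sums_mult)
  moreover have "(1 - p) powr n * (1 + (-p)) powr (-n) = 1"
    using assms by (simp flip: powr_add)
  moreover have "(1 - p) powr n * (((-n) gchoose x) * (-p) ^ x) = negbin_mass n p x" for x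
  proof -
    have "n \<notin> \<int>\<^sub>\<le>\<^sub>0" using assms by (auto elim!: nonpos_Ints_cases)
    then have "pochhammer n x = Gamma (real x + n) / Gamma n"
      by (simp add: pochhammer_Gamma add.commute)
    moreover have "(-1) ^ x * (-p) ^ x = p ^ x"
      by (simp flip: power_mult_distrib)
    ultimately show ?thesis
      by (simp add: gbinomial_pochhammer negbin_mass_def field_simps)
  qed
  ultimately show ?thesis by simp
qed

lemma pmf_negbin:
  assumes "n > 0" "0 < p" "p < 1"
  shows "pmf (negbin_pmf n p) x = negbin_mass n p x"
  unfolding negbin_pmf_def
proof (rule pmf_embed_pmf)
  show "0 \<le> negbin_mass n p x" for x
    using assms by (rule negbin_mass_nonneg)
  show "(\<integral>\<^sup>+ x. ennreal (negbin_mass n p x) \<partial>count_space UNIV) = 1"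
    using suminf_ennreal_eq[OF negbin_mass_nonneg negbin_mass_sums, OF assms assms]
    by (simp add: nn_integral_count_space_nat)
qed

definition rv_mass :: "'a measure \<Rightarrow> ('a \<Rightarrow> int) \<Rightarrow> int \<Rightarrow> real" where
  "rv_mass M X x = measure M {\<omega> \<in> space M. X \<omega> = x}"

definition rv_support :: "'a measure \<Rightarrow> ('a \<Rightarrow> int) \<Rightarrow> int set" where
  "rv_support M X = {x. rv_mass M X x > 0}"

text \<open>All summands below are nonnegative, the last ones because \<open>x - r\<close> is an integer, so
  unconditional summation is no restriction. Note that \<open>infsum\<close> is \<open>0\<close> for a divergent sum.\<close>

definition first_order_loss :: "'a measure \<Rightarrow> ('a \<Rightarrow> int) \<Rightarrow> int \<Rightarrow> real" where
  "first_order_loss M X r =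
    (\<Sum>\<^sub>\<infinity>x \<in> {x \<in> rv_support M X. x \<ge> r}. real_of_int (x - r) * rv_mass M X x)"

definition complementary_loss :: "'a measure \<Rightarrow> ('a \<Rightarrow> int) \<Rightarrow> int \<Rightarrow> real" where
  "complementary_loss M X r =
    (\<Sum>\<^sub>\<infinity>x \<in> {x \<in> rv_support M X. x \<le> r}. real_of_int (r - x) * rv_mass M X x)"

definition second_order_loss :: "'a measure \<Rightarrow> ('a \<Rightarrow> int) \<Rightarrow> int \<Rightarrow> real" where
  "second_order_loss M X r = 1 / 2 *
    (\<Sum>\<^sub>\<infinity>x \<in> {x \<in> rv_support M X. x \<ge> r}.
      real_of_int (x - r) * real_of_int (x - r - 1) * rv_mass M X x)"

end

theory Submission
  imports Defs
begin

text \<open>The mass functions satisfy \<open>x f\<^sub>n(x) = np/(1-p) f\<^sub>n\<^sub>+\<^sub>1(x-1)\<close>, so that the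
  factorial moments of \<open>X\<close> restricted to a set \<open>A\<close> are probabilities of shifts of \<open>A\<close> under the
  distributions with parameters \<open>n + 1\<close> and \<open>n + 2\<close>. The loss functions are linear
  combinations of these restricted moments, by
  \<open>(x-r)(x-r-1) = x(x-1) - 2rx + (r\<^sup>2+r)\<close>.\<close>

text \<open>Absolute summability of a pmf turns the \<open>infsetsum\<close> formula for its measure
  into an unconditional sum.\<close>

lemma has_sum_pmf: "(pmf q has_sum measure_pmf.prob q A) A"
  using pmf_abs_summable[of q A]
  by (metis abs_summable_equivalent abs_summable_summable has_sum_infsum infsetsum_infsum
      measure_pmf_conv_infsetsum)

text \<open>Only 0 can lie in \<open>A\<close> without being a successor, and there \<open>f\<close>
  vanishes, so the sum reindexes along the injective \<open>Suc\<close>.\<close>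

lemma has_sum_vimage_Suc:
  fixes f g :: "nat \<Rightarrow> real"
  assumes "(g has_sum S) (Suc -` A)" and "\<And>y. f (Suc y) = g y" and "f 0 = 0"
  shows "(f has_sum S) A"
proof -
  have "(f has_sum S) (Suc ` (Suc -` A))"
    using assms(1,2) by (subst has_sum_reindex) (auto simp: o_def)
  moreover have "x = 0" if "x \<in> A - Suc ` (Suc -` A)" for x
    using that by (cases x) auto
  ultimately show ?thesis
    using assms(3) by (subst has_sum_cong_neutral[where T = "Suc ` (Suc -` A)" and g = f]) auto
qed

context
  fixes n p :: real
  assumes n: "n > 0" and p: "0 < p" "p < 1"
begin

lemma negbin_mass_pos: "negbin_mass n p x > 0"
  using n p by (auto simp: negbin_mass_def intro!: mult_pos_pos divide_pos_pos Gamma_real_pos)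

text \<open>The factor \<open>Suc x\<close> cancels against \<open>fact (Suc x)\<close>, while the
  Gamma argument \<open>Suc x + n\<close> regroups as \<open>x + (n + 1)\<close>; raising
  \<open>n\<close> in \<open>Gamma n\<close> and in the power of \<open>1 - p\<close> costs the
  factors \<open>n\<close> and \<open>1 - p\<close>.\<close>

lemma negbin_mass_Suc:
  "real (Suc x) * negbin_mass n p (Suc x) = n * p / (1 - p) * negbin_mass (n + 1) p x"
proof -
  have Gamma_plus: "Gamma (n + 1) = n * Gamma n"
    using n by (subst Gamma_plus1) auto
  have powr_plus: "(1 - p) powr (n + 1) = (1 - p) * (1 - p) powr n"
    using p by (simp add: powr_add)
  have Gamma_arg: "real (Suc x) + n = real x + (n + 1)"
    by simp
  \<comment> \<open>The Gamma values, the factorial and the powers are generalised to variables, so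
    that only \<open>s\<close>, \<open>n\<close> and \<open>1 - p\<close> have to be
    cancelled.\<close>
  have "s * (h / (g * (s * k)) * q * (p * y)) =
      n * p / (1 - p) * (h / (n * g * k) * ((1 - p) * q) * y)"
    if "s > 0" for s h g k q y :: real
    using n p that by (simp add: divide_simps)
  from this[of "real (Suc x)"] show ?thesis
    unfolding negbin_mass_def fact_Suc power_Suc of_nat_mult Gamma_arg Gamma_plus powr_plus
    by simp
qed

lemma has_sum_negbin_mass:
  "(negbin_mass n p has_sum measure_pmf.prob (negbin_pmf n p) A) A"
  using has_sum_pmf[of "negbin_pmf n p" A] pmf_negbin[OF n p] by (simp cong: has_sum_cong)

text \<open>For negative \<open>k\<close> the set is empty, so no case distinction on the sign of
  \<open>r\<close> is needed later.\<close>

lemma negbin_cdf_of_int: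
  "negbin_cdf n p (real_of_int k) = measure_pmf.prob (negbin_pmf n p) {x. int x \<le> k}"
proof -
  have "real x \<le> real_of_int k \<longleftrightarrow> int x \<le> k" for x
    by linarith
  then show ?thesis
    by (simp add: negbin_cdf_def cdf_def vimage_def)
qed

lemma one_minus_negbin_cdf_of_int:
  "1 - negbin_cdf n p (real_of_int k) = measure_pmf.prob (negbin_pmf n p) {x. k < int x}"
proof -
  have "{x. k < int x} = UNIV - {x. int x \<le> k}" by auto
  then show ?thesis
    using measure_pmf.prob_compl[of "{x. int x \<le> k}" "negbin_pmf n p"]
    by (simp add: negbin_cdf_of_int)
qed

end

lemma has_sum_negbin_first_moment:
  assumes "n > 0" "0 < p" "p < 1"
  shows "((\<lambda>x. real x * negbin_mass n p x) has_sum
    n * p / (1 - p) * measure_pmf.prob (negbin_pmf (n + 1) p) (Suc -` A)) A"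
proof (rule has_sum_vimage_Suc)
  show "((\<lambda>y. n * p / (1 - p) * negbin_mass (n + 1) p y) has_sum
    n * p / (1 - p) * measure_pmf.prob (negbin_pmf (n + 1) p) (Suc -` A)) (Suc -` A)"
    using assms by (intro has_sum_cmult_right has_sum_negbin_mass) auto
qed (simp_all only: negbin_mass_Suc[OF assms] of_nat_0 mult_zero_left)

text \<open>One use of the recurrence turns the factor \<open>x\<close> into a shift and leaves
  \<open>x - 1\<close> as the first-moment weight for parameter \<open>n + 1\<close>. The constant
  is the product of the two factors \<open>n * p / (1 - p)\<close> and
  \<open>(n + 1) * p / (1 - p)\<close>.\<close>

lemma has_sum_negbin_second_factorial_moment:
  assumes "n > 0" "0 < p" "p < 1"
  shows "((\<lambda>x. real x * (real x - 1) * negbin_mass n p x) has_sum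
    ((n * p) ^ 2 + n * p ^ 2) / (1 - p) ^ 2 *
      measure_pmf.prob (negbin_pmf (n + 2) p) (Suc -` Suc -` A)) A"
proof (rule has_sum_vimage_Suc)
  have "((\<lambda>y. n * p / (1 - p) * (real y * negbin_mass (n + 1) p y)) has_sum
    n * p / (1 - p) * ((n + 1) * p / (1 - p) *
      measure_pmf.prob (negbin_pmf (n + 1 + 1) p) (Suc -` Suc -` A))) (Suc -` A)"
    using assms by (intro has_sum_cmult_right has_sum_negbin_first_moment) auto
  moreover have "((n * p) ^ 2 + n * p ^ 2) / (1 - p) ^ 2 =
    n * p / (1 - p) * ((n + 1) * p / (1 - p))"
    by (simp add: power2_eq_square field_simps)
  ultimately show "((\<lambda>y. n * p / (1 - p) * (real y * negbin_mass (n + 1) p y)) has_sum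
    ((n * p) ^ 2 + n * p ^ 2) / (1 - p) ^ 2 *
      measure_pmf.prob (negbin_pmf (n + 2) p) (Suc -` Suc -` A)) (Suc -` A)"
    by (simp only: mult.assoc add.assoc one_add_one)
  show "real (Suc y) * (real (Suc y) - 1) * negbin_mass n p (Suc y) =
    n * p / (1 - p) * (real y * negbin_mass (n + 1) p y)" for y
    using arg_cong[OF negbin_mass_Suc[OF assms, of y], of "\<lambda>z. real y * z"]
    by (simp only: of_nat_Suc add_diff_cancel_left' mult.left_commute mult.commute mult.assoc)
qed simp

text \<open>The masses are prescribed only at nonnegative integers. They already add up to 1, which
  leaves no mass for negative values, and each of them is positive.\<close>

lemma rv_support_negbin:
  assumes "prob_space M" and "X \<in> measurable M (count_space UNIV)"
    and "n > 0" "0 < p" "p < 1"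
    and mass: "\<And>x::nat. rv_mass M X (int x) = negbin_mass n p x"
  shows "rv_support M X = range int"
proof -
  interpret prob_space M by fact
  define E where "E = (\<lambda>x. {\<omega> \<in> space M. X \<omega> = x})"
  have E [measurable]: "E x \<in> sets M" for x
    using measurable_sets[OF assms(2), of "{x}"]
    by (simp add: E_def vimage_def Int_def conj_commute)
  have "(\<lambda>i. prob (E (int i))) sums prob (\<Union>i. E (int i))"
    by (intro finite_measure_UNION) (use E in \<open>auto simp: disjoint_family_on_def E_def\<close>)
  moreover have "(\<lambda>i. prob (E (int i))) sums 1"
    using negbin_mass_sums[OF assms(3-5)] mass by (simp add: rv_mass_def E_def)
  ultimately have total: "prob (\<Union>i. E (int i)) = 1"
    by (rule sums_unique2)
  have "rv_mass M X x = 0" if "x \<notin> range int" for x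
  proof -
    have disjoint: "E x \<inter> (\<Union>i. E (int i)) = {}"
      using that by (auto simp: E_def)
    \<comment> \<open>The union has probability 1, so an event disjoint from it must be
      null.\<close>
    have "prob (E x) + prob (\<Union>i. E (int i)) = prob (E x \<union> (\<Union>i. E (int i)))"
      by (intro finite_measure_Union[symmetric] disjoint) measurable
    also have "\<dots> \<le> 1" by simp
    finally show ?thesis
      using total by (simp add: rv_mass_def E_def order_antisym)
  qed
  moreover have "rv_mass M X (int x) > 0" for x
    using mass negbin_mass_pos[OF assms(3-5)] by simp
  ultimately show ?thesis
    by (force simp: rv_support_def)
qed

theorem mainTheorem1:
  fixes M :: "'a measure" and X :: "'a \<Rightarrow> int" and n p :: real and r :: int
  assumes "prob_space M"
    and "X \<in> measurable M (count_space UNIV)"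
    and "n > 0" and "0 < p" and "p < 1"
    and "\<And>x::nat. rv_mass M X (int x) = negbin_mass n p x"
  shows "first_order_loss M X r =
           n * p / (1 - p) * (1 - negbin_cdf (n + 1) p (real_of_int (r - 2)))
           - real_of_int r * (1 - negbin_cdf n p (real_of_int (r - 1)))
       \<and> complementary_loss M X r =
           real_of_int r * negbin_cdf n p (real_of_int (r - 1))
           - n * p / (1 - p) * negbin_cdf (n + 1) p (real_of_int (r - 2))
       \<and> second_order_loss M X r =
           (real_of_int r ^ 2 + real_of_int r) / 2 * (1 - negbin_cdf n p (real_of_int (r - 1)))
           - real_of_int r * n * p / (1 - p) * (1 - negbin_cdf (n + 1) p (real_of_int (r - 2)))
           + ((n * p) ^ 2 + n * p ^ 2) / (2 * (1 - p) ^ 2)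
             * (1 - negbin_cdf (n + 2) p (real_of_int (r - 3)))"
proof -
  note np = assms(3-5)
  define f where "f = negbin_mass n p"
  define R where "R = real_of_int r"
  define c where "c = n * p / (1 - p)"
  define d where "d = ((n * p) ^ 2 + n * p ^ 2) / (1 - p) ^ 2"
  define F0 where "F0 = negbin_cdf n p (real_of_int (r - 1))"
  define F1 where "F1 = negbin_cdf (n + 1) p (real_of_int (r - 2))"
  define F2 where "F2 = negbin_cdf (n + 2) p (real_of_int (r - 3))"
  define U where "U = {x. r \<le> int x}"
  define L where "L = {x. int x < r}"

  have supp: "rv_support M X = range int"
    using assms by (rule rv_support_negbin)
  \<comment> \<open>Since the support is the range of the injective \<open>int\<close>, each loss
    becomes a sum over natural numbers.\<close>
  have infsum_int: "infsum (\<lambda>x. g x * rv_mass M X x) {x \<in> rv_support M X. P x} =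
    infsum (\<lambda>x. g (int x) * f x) {x. P (int x)}" for g :: "int \<Rightarrow> real" and P
  proof -
    have "{x \<in> rv_support M X. P x} = int ` {x. P (int x)}"
      by (auto simp: supp)
    then show ?thesis
      by (simp add: infsum_reindex o_def assms(6) f_def)
  qed

  \<comment> \<open>Each preimage under \<open>Suc\<close> lowers the threshold by one. Starting
    from \<open>r - 1\<close>, this gives the arguments \<open>r - 2\<close> and
    \<open>r - 3\<close> of the shifted distributions.\<close>
  have U1: "Suc -` U = {x. r - 2 < int x}" and U2: "Suc -` {x. r - 2 < int x} = {x. r - 3 < int x}"
    and U0: "U = {x. r - 1 < int x}"
    and L0: "L = {x. int x \<le> r - 1}" and L1: "Suc -` L = {x. int x \<le> r - 2}"
    by (auto simp: U_def L_def)
  have sU0: "(f has_sum (1 - F0)) U"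
    using has_sum_negbin_mass[OF np, of U] one_minus_negbin_cdf_of_int[OF np, of "r - 1"]
    by (simp add: f_def F0_def U0)
  have sU1: "((\<lambda>x. real x * f x) has_sum c * (1 - F1)) U"
    using has_sum_negbin_first_moment[OF np, of U]
      one_minus_negbin_cdf_of_int[of "n + 1" p "r - 2"] np
    by (simp add: f_def F1_def U1 c_def)
  have sU2: "((\<lambda>x. real x * (real x - 1) * f x) has_sum d * (1 - F2)) U"
    using has_sum_negbin_second_factorial_moment[OF np, of U]
      one_minus_negbin_cdf_of_int[of "n + 2" p "r - 3"] np
    unfolding f_def F2_def U1 U2 d_def by simp
  have sL0: "(f has_sum F0) L"
    using has_sum_negbin_mass[OF np, of L] negbin_cdf_of_int[OF np, of "r - 1"]
    by (simp add: f_def F0_def L0)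
  have sL1: "((\<lambda>x. real x * f x) has_sum c * F1) L"
    using has_sum_negbin_first_moment[OF np, of L] negbin_cdf_of_int[of "n + 1" p "r - 2"] np
    by (simp add: f_def F1_def L1 c_def)

  \<comment> \<open>Working with \<open>has_sum\<close> establishes convergence, so the loss is not
    the default value 0 of \<open>infsum\<close>.\<close>
  have "((\<lambda>x. real x * f x + (- R) * f x) has_sum (c * (1 - F1) + (- R) * (1 - F0))) U"
    by (intro has_sum_add has_sum_cmult_right sU0 sU1)
  then have "((\<lambda>x. real_of_int (int x - r) * f x) has_sum (c * (1 - F1) - R * (1 - F0))) U"
    by (simp add: R_def algebra_simps)
  then have first: "first_order_loss M X r = c * (1 - F1) - R * (1 - F0)"
    unfolding first_order_loss_def infsum_int U_def[symmetric] by (rule infsumI)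

  have "((\<lambda>x. R * f x + (- 1) * (real x * f x)) has_sum (R * F0 + (- 1) * (c * F1))) L"
    by (intro has_sum_add has_sum_cmult_right sL0 sL1)
  then have "((\<lambda>x. real_of_int (r - int x) * f x) has_sum (R * F0 - c * F1)) L"
    by (simp add: R_def algebra_simps)
  \<comment> \<open>The loss also includes \<open>x = r\<close>, where the summand is 0. Summing
    over \<open>L\<close> instead is what yields the cdf arguments \<open>r - 1\<close> and
    \<open>r - 2\<close>.\<close>
  then have "((\<lambda>x. real_of_int (r - int x) * f x) has_sum (R * F0 - c * F1)) {x. int x \<le> r}"
    by (subst has_sum_cong_neutral[where T = L and g = "\<lambda>x. real_of_int (r - int x) * f x"])
      (auto simp: L_def)
  then have compl: "complementary_loss M X r = R * F0 - c * F1"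
    unfolding complementary_loss_def infsum_int by (rule infsumI)

  have "((\<lambda>x. (real x * (real x - 1) * f x + (- 2 * R) * (real x * f x)) + (R ^ 2 + R) * f x) has_sum
    (d * (1 - F2) + (- 2 * R) * (c * (1 - F1))) + (R ^ 2 + R) * (1 - F0)) U"
    by (intro has_sum_add has_sum_cmult_right sU0 sU1 sU2)
  moreover have "(\<lambda>x. (real x * (real x - 1) * f x + (- 2 * R) * (real x * f x)) + (R ^ 2 + R) * f x) =
    (\<lambda>x. real_of_int (int x - r) * real_of_int (int x - r - 1) * f x)"
    by (simp add: R_def algebra_simps power2_eq_square)
  ultimately have "((\<lambda>x. real_of_int (int x - r) * real_of_int (int x - r - 1) * f x) has_sum
    (d * (1 - F2) + (- 2 * R) * (c * (1 - F1))) + (R ^ 2 + R) * (1 - F0)) U"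
    by simp
  then have "second_order_loss M X r =
    1 / 2 * ((d * (1 - F2) + (- 2 * R) * (c * (1 - F1))) + (R ^ 2 + R) * (1 - F0))"
    unfolding second_order_loss_def infsum_int U_def[symmetric] by (simp only: infsumI)
  \<comment> \<open>Halving turns \<open>- 2 * R\<close> into \<open>- R\<close>, and
    \<open>d / 2\<close> is the last coefficient of the claim.\<close>
  also have "\<dots> = (R ^ 2 + R) / 2 * (1 - F0) - R * c * (1 - F1) + d / 2 * (1 - F2)"
    by (simp add: field_simps)
  finally have second: "second_order_loss M X r =
    (R ^ 2 + R) / 2 * (1 - F0) - R * c * (1 - F1) + d / 2 * (1 - F2)" .

  show ?thesis
    using first compl second unfolding F0_def F1_def F2_def R_def c_def d_def
    by (simp add: mult.assoc mult.commute[of "2::real"])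
qed

end
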